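(* For the cyclic biquandle $C_3$ of order $3$, $H_3^{YB}(C_3)\cong\mathbb{Z}^9\oplus\mathbb{Z}/3\mathbb{Z}$.
   Context: The cyclic biquandle $C_m$ of order $m$ is the set $\mathbb{Z}/m\mathbb{Z}$ with the map $R(a,b)=(b+1,a-1)$. Its set-theoretic Yang-Baxter chain complex: for $n\ge 1$, $C_n^{YB}(C_m)$ is the free abelian group with basis $(C_m)^n$, and $C_n^{YB}(C_m)=0$ for $n\le 0$. The boundary is $\partial_n=\sum_{i=1}^n(-1)^{i-1}(d^l_{i,n}-d^r_{i,n})$ for $n\ge 2$ (and $\partial_n=0$ for $n\le 1$), where on basis elements $$d^l_{i,n}(x_1,\ldots,x_n)=(x_1-1,\ldots,x_{i-1}-1,x_{i+1},\ldots,x_n),$$ $$d^r_{i,n}(x_1,\ldots,x_n)=(x_1,\ldots,x_{i-1},x_{i+1}+1,\ldots,x_n+1).$$ $H_n^{YB}(C_m)$ is the $n$th homology group of this complex of abelian groups. *)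

theory Defs
  imports "HOL-Algebra.Algebra"
begin

text \<open>
  The cyclic biquandle of order \<open>m > 0\<close> has the underlying set \<open>\<int>/m\<int>\<close>, represented by the carrier
  \<open>{0..<m}\<close> of \<^const>\<open>integer_mod_group\<close> \<open>m\<close>, and the map \<open>R (a, b) = (b + 1, a - 1)\<close>. A basis
  element of the chain group in degree \<open>n\<close> is a list \<open>[x\<^sub>1, \<dots>, x\<^sub>n]\<close>. Degrees are integers, so that the
  complex is also defined (and zero) in degrees \<open>n \<le> 0\<close>; in particular the empty list is not a
  basis element in degree 0.
\<close>

definition YB_basis :: "nat \<Rightarrow> int \<Rightarrow> int list set" where
  "YB_basis m n =
     {xs. 1 \<le> n \<and> int (length xs) = n \<and> set xs \<subseteq> carrier (integer_mod_group m)}"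

definition YB_chain_group :: "nat \<Rightarrow> int \<Rightarrow> (int list \<Rightarrow>\<^sub>0 int) monoid" where
  "YB_chain_group m n = free_Abelian_group (YB_basis m n)"

text \<open>
  The face maps remove the \<open>i\<close>-th entry, counting from 1. Its passage to the left end (for \<open>YB_dl\<close>)
  or to the right end (for \<open>YB_dr\<close>) by repeated application of \<open>R\<close> shifts the entries it crosses.
\<close>

definition YB_dl :: "nat \<Rightarrow> nat \<Rightarrow> int list \<Rightarrow> int list" where
  "YB_dl m i xs = map (\<lambda>x. (x - 1) mod int m) (take (i - 1) xs) @ drop i xs"

definition YB_dr :: "nat \<Rightarrow> nat \<Rightarrow> int list \<Rightarrow> int list" where
  "YB_dr m i xs = take (i - 1) xs @ map (\<lambda>x. (x + 1) mod int m) (drop i xs)"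

definition YB_boundary :: "nat \<Rightarrow> int \<Rightarrow> (int list \<Rightarrow>\<^sub>0 int) \<Rightarrow> (int list \<Rightarrow>\<^sub>0 int)" where
  "YB_boundary m n c =
     (if n \<le> 1 then 0
      else frag_extend
             (\<lambda>xs. \<Sum>i = 1..nat n.
                frag_cmul ((- 1) ^ (i - 1)) (frag_of (YB_dl m i xs) - frag_of (YB_dr m i xs))) c)"

definition YB_cycles :: "nat \<Rightarrow> int \<Rightarrow> (int list \<Rightarrow>\<^sub>0 int) set" where
  "YB_cycles m n = kernel (YB_chain_group m n) (YB_chain_group m (n - 1)) (YB_boundary m n)"

definition YB_boundaries :: "nat \<Rightarrow> int \<Rightarrow> (int list \<Rightarrow>\<^sub>0 int) set" where
  "YB_boundaries m n = YB_boundary m (n + 1) ` carrier (YB_chain_group m (n + 1))"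

definition YB_homology_group :: "nat \<Rightarrow> int \<Rightarrow> (int list \<Rightarrow>\<^sub>0 int) set monoid" where
  "YB_homology_group m n =
     subgroup_generated (YB_chain_group m n) (YB_cycles m n) Mod YB_boundaries m n"

end

theory Submission
  imports Defs
begin

text \<open>
  In the coordinates \<open>y\<^sub>j = x\<^sub>j + j\<close> the map \<open>d\<^sup>r\<^sub>i\<close> deletes \<open>y\<^sub>i\<close>, and \<open>d\<^sup>l\<^sub>i\<close> deletes \<open>y\<^sub>i\<close> and then
  decreases all entries by 1. So \<open>\<partial> = (t - 1) \<delta>\<close>, where \<open>\<delta>\<close> is the boundary of the full simplex on
  \<open>G = \<int>/m\<int>\<close>, which is acyclic by coning, and \<open>t\<close> is the diagonal translation, which acts freely. A chain \<open>c\<close> is a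
  cycle iff \<open>\<delta> c\<close> is \<open>t\<close>-invariant, and the boundaries are \<open>(t - 1) ker \<delta>\<close>.

  For \<open>m = n = 3\<close>, the coefficients of \<open>\<delta> c\<close> (3 orbits) and of the image of \<open>c\<close> in the coinvariants
  \<open>\<int>[G\<^sup>2]\<close> (9 orbits, 3 coefficients being determined by the rest) give the free part. If they vanish
  then \<open>c = (t - 1) e\<close> with \<open>\<delta> e\<close> invariant, say \<open>\<delta> e = (1 + t + t\<^sup>2) u\<close> with \<open>u \<in> \<int>[G]\<close>.
  Changing \<open>e\<close> by an invariant chain changes \<open>u\<close> by a boundary of the bar complex, and
  \<open>H\<^sub>1(G, \<int>) = \<int>/3\<close>, through \<open>u \<mapsto> \<Sum>\<^sub>g g u\<^sub>g\<close>, is the only obstruction to achieving \<open>\<delta> e = 0\<close>.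
\<close>

section \<open>Translation, simplex boundary, cone and orbit operators on chains\<close>

definition shift_list :: "nat \<Rightarrow> int list \<Rightarrow> int list" where
  "shift_list m xs = map (\<lambda>x. (x - 1) mod int m) xs"

definition shift :: "nat \<Rightarrow> (int list \<Rightarrow>\<^sub>0 int) \<Rightarrow> (int list \<Rightarrow>\<^sub>0 int)" where
  "shift m = frag_extend (\<lambda>xs. frag_of (shift_list m xs))"

definition face_sum :: "nat \<Rightarrow> int list \<Rightarrow> (int list \<Rightarrow>\<^sub>0 int)" where
  "face_sum m xs = (\<Sum>i = 1..length xs. frag_cmul ((- 1) ^ (i - 1)) (frag_of (YB_dr m i xs)))"

definition delta :: "nat \<Rightarrow> (int list \<Rightarrow>\<^sub>0 int) \<Rightarrow> (int list \<Rightarrow>\<^sub>0 int)" where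
  "delta m = frag_extend (face_sum m)"

text \<open>In the coordinates \<open>y\<^sub>j\<close> this prepends the vertex 1: each entry moves
  one place to the right, so 1 is subtracted from it to keep its \<open>y\<close>.\<close>

definition cone_chain :: "nat \<Rightarrow> (int list \<Rightarrow>\<^sub>0 int) \<Rightarrow> (int list \<Rightarrow>\<^sub>0 int)" where
  "cone_chain m = frag_extend (\<lambda>xs. frag_of (0 # shift_list m xs))"

text \<open>The orbit representatives are the lists with first entry 0.\<close>

definition orbit_rep :: "nat \<Rightarrow> (int list \<Rightarrow>\<^sub>0 int) \<Rightarrow> (int list \<Rightarrow>\<^sub>0 int)" where
  "orbit_rep m = frag_extend (\<lambda>xs. frag_of (map (\<lambda>x. (x - hd xs) mod int m) xs))"

text \<open>An inverse of \<open>t - 1\<close> up to orbit representatives: the translates met while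
  the first entry descends to 0, the last one excluded, are summed with a minus sign, so that
  \<open>t - 1\<close> telescopes.\<close>

definition slide :: "nat \<Rightarrow> (int list \<Rightarrow>\<^sub>0 int) \<Rightarrow> (int list \<Rightarrow>\<^sub>0 int)" where
  "slide m = frag_extend
     (\<lambda>xs. - (\<Sum>k<nat (hd xs). frag_of (map (\<lambda>x. (x - int k) mod int m) xs)))"

lemmas chain_map_defs = shift_def delta_def cone_chain_def orbit_rep_def slide_def

lemma
  shift_diff: "shift m (a - b) = shift m a - shift m b" and
  delta_diff: "delta m (a - b) = delta m a - delta m b" and
  cone_chain_diff: "cone_chain m (a - b) = cone_chain m a - cone_chain m b" and
  orbit_rep_diff: "orbit_rep m (a - b) = orbit_rep m a - orbit_rep m b" and
  slide_diff: "slide m (a - b) = slide m a - slide m b"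
  by (simp_all add: chain_map_defs frag_extend_diff)

lemma
  shift_add: "shift m (a + b) = shift m a + shift m b" and
  delta_add: "delta m (a + b) = delta m a + delta m b" and
  orbit_rep_add: "orbit_rep m (a + b) = orbit_rep m a + orbit_rep m b" and
  slide_add: "slide m (a + b) = slide m a + slide m b"
  by (simp_all add: chain_map_defs frag_extend_add)

lemma delta_minus: "delta m (- a) = - delta m a"
  by (simp add: delta_def frag_extend_minus)

lemma
  shift_cmul: "shift m (frag_cmul k a) = frag_cmul k (shift m a)" and
  delta_cmul: "delta m (frag_cmul k a) = frag_cmul k (delta m a)" and
  orbit_rep_cmul: "orbit_rep m (frag_cmul k a) = frag_cmul k (orbit_rep m a)" and
  slide_cmul: "slide m (frag_cmul k a) = frag_cmul k (slide m a)"
  by (simp_all add: chain_map_defs frag_extend_cmul)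

lemma
  shift_zero [simp]: "shift m 0 = 0" and
  delta_zero [simp]: "delta m 0 = 0" and
  cone_chain_zero [simp]: "cone_chain m 0 = 0" and
  orbit_rep_zero [simp]: "orbit_rep m 0 = 0" and
  slide_zero [simp]: "slide m 0 = 0"
  by (simp_all add: chain_map_defs)

lemma
  shift_of [simp]: "shift m (frag_of xs) = frag_of (shift_list m xs)" and
  delta_of [simp]: "delta m (frag_of xs) = face_sum m xs" and
  cone_chain_of [simp]: "cone_chain m (frag_of xs) = frag_of (0 # shift_list m xs)" and
  orbit_rep_of [simp]:
    "orbit_rep m (frag_of xs) = frag_of (map (\<lambda>x. (x - hd xs) mod int m) xs)" and
  slide_of [simp]: "slide m (frag_of xs) =
    - (\<Sum>k<nat (hd xs). frag_of (map (\<lambda>x. (x - int k) mod int m) xs))"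
  by (simp_all add: chain_map_defs)

lemmas chain_map_linear =
  shift_add shift_diff shift_cmul delta_add delta_diff delta_minus delta_cmul
  orbit_rep_add orbit_rep_diff orbit_rep_cmul
  slide_add slide_diff slide_cmul

section \<open>Supports of the images\<close>

lemma length_YB_dr: "i \<in> {1..length xs} \<Longrightarrow> length (YB_dr m i xs) = length xs - 1"
  by (auto simp: YB_dr_def)

lemma shift_list_YB_dr: "shift_list m (YB_dr m i xs) = YB_dr m i (shift_list m xs)"
  by (simp add: shift_list_def YB_dr_def take_map drop_map mod_simps)

lemma YB_dr_in_basis:
  assumes "0 < m" "xs \<in> YB_basis m n" "2 \<le> n" "i \<in> {1..length xs}"
  shows "YB_dr m i xs \<in> YB_basis m (n - 1)"
proof -
  have "set (YB_dr m i xs) \<subseteq> {0..<int m}"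
    using assms by (auto simp: YB_basis_def YB_dr_def carrier_integer_mod_group
        dest!: in_set_takeD in_set_dropD)
  then show ?thesis
    using assms by (auto simp: YB_basis_def length_YB_dr carrier_integer_mod_group)
qed

lemma shift_list_in_basis:
  assumes "0 < m" "xs \<in> YB_basis m n"
  shows "shift_list m xs \<in> YB_basis m n"
  using assms by (auto simp: YB_basis_def shift_list_def carrier_integer_mod_group)

lemma keys_shift:
  assumes "0 < m" "Poly_Mapping.keys c \<subseteq> YB_basis m n"
  shows "Poly_Mapping.keys (shift m c) \<subseteq> YB_basis m n"
  using assms(2)
proof (induction c rule: frag_induction)
  case (diff a b)
  then show ?case using keys_diff[of "shift m a" "shift m b"] by (auto simp: shift_diff)
qed (use assms(1) in \<open>auto simp: shift_list_in_basis keys_frag_of\<close>)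

lemma keys_delta:
  assumes "0 < m" "2 \<le> n" "Poly_Mapping.keys c \<subseteq> YB_basis m n"
  shows "Poly_Mapping.keys (delta m c) \<subseteq> YB_basis m (n - 1)"
  using assms(3)
proof (induction c rule: frag_induction)
  case (one xs)
  have "Poly_Mapping.keys (face_sum m xs) \<subseteq> (\<Union>i\<in>{1..length xs}. {YB_dr m i xs})"
    unfolding face_sum_def by (rule order_trans[OF keys_sum]) (auto simp: keys_frag_of)
  then show ?case
    using YB_dr_in_basis[OF assms(1) one assms(2)] by auto
next
  case (diff a b)
  then show ?case using keys_diff[of "delta m a" "delta m b"] by (auto simp: delta_diff)
qed simp

lemma keys_cone_chain:
  assumes "0 < m" "Poly_Mapping.keys c \<subseteq> YB_basis m n"
  shows "Poly_Mapping.keys (cone_chain m c) \<subseteq> YB_basis m (n + 1)"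
  using assms(2)
proof (induction c rule: frag_induction)
  case (one xs)
  with assms(1) show ?case
    by (auto simp: keys_frag_of YB_basis_def shift_list_def carrier_integer_mod_group)
next
  case (diff a b)
  then show ?case using keys_diff[of "cone_chain m a" "cone_chain m b"] by (auto simp: cone_chain_diff)
qed simp

lemma keys_slide:
  assumes "0 < m" "Poly_Mapping.keys c \<subseteq> YB_basis m n"
  shows "Poly_Mapping.keys (slide m c) \<subseteq> YB_basis m n"
  using assms(2)
proof (induction c rule: frag_induction)
  case (one xs)
  have "Poly_Mapping.keys (\<Sum>k<nat (hd xs). frag_of (map (\<lambda>x. (x - int k) mod int m) xs))
      \<subseteq> (\<Union>k\<in>{..<nat (hd xs)}. {map (\<lambda>x. (x - int k) mod int m) xs})"
    by (rule order_trans[OF keys_sum]) (auto simp: keys_frag_of)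
  also have "\<dots> \<subseteq> YB_basis m n"
    using assms(1) one by (auto simp: YB_basis_def carrier_integer_mod_group)
  finally show ?case by simp
next
  case (diff a b)
  then show ?case using keys_diff[of "slide m a" "slide m b"] by (auto simp: slide_diff)
qed simp

section \<open>The identity \<open>\<partial> = (t - 1) \<delta>\<close>, coning, and translation
  orbits\<close>

lemma shift_delta: "shift m (delta m c) = delta m (shift m c)"
  using subset_UNIV
proof (induction c rule: frag_induction)
  case (one xs)
  have "shift m (face_sum m xs) = face_sum m (shift_list m xs)"
    unfolding face_sum_def shift_def
    by (simp add: frag_extend_sum o_def frag_extend_cmul shift_list_YB_dr)
      (simp add: shift_list_def)
  then show ?case by simp
qed (auto simp: shift_diff delta_diff)

lemma frag_cmul_diff_distrib2: "frag_cmul k (a - b) = frag_cmul k a - frag_cmul k b"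
  by (rule poly_mapping_eqI) (simp add: lookup_minus right_diff_distrib)

lemma YB_boundary_eq:
  assumes "2 \<le> n" "Poly_Mapping.keys c \<subseteq> YB_basis m n"
  shows "YB_boundary m n c = shift m (delta m c) - delta m c"
  using assms(2)
proof (induction c rule: frag_induction)
  case (one xs)
  \<comment> \<open>Translation cancels the 1 that \<open>YB_dr\<close> adds behind the deleted
    entry and leaves the -1 in front of it; the entries behind are already reduced.\<close>
  have dl: "YB_dl m i xs = shift_list m (YB_dr m i xs)" for i
  proof -
    have "map (\<lambda>x. x mod int m) (drop i xs) = drop i xs"
      using one by (intro map_idI)
        (auto simp: YB_basis_def carrier_integer_mod_group split: if_splits dest!: in_set_dropD)
    then show ?thesis
      by (simp add: YB_dl_def YB_dr_def shift_list_def mod_simps o_def)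
  qed
  have "length xs = nat n" using one by (auto simp: YB_basis_def)
  then show ?case
    using assms(1) unfolding YB_boundary_def delta_of face_sum_def shift_def
    by (simp add: frag_extend_sum o_def frag_extend_cmul dl frag_cmul_diff_distrib2
        flip: sum_subtractf)
next
  case (diff a b)
  then show ?case
    using assms(1) by (simp add: YB_boundary_def frag_extend_diff shift_diff delta_diff)
qed (auto simp: YB_boundary_def)

text \<open>Deleting the apex returns the list; deleting a later vertex gives the cone over a face,
  with opposite sign because positions move up by one.\<close>

lemma delta_cone_chain:
  assumes "Poly_Mapping.keys c \<subseteq> YB_basis m n"
  shows "delta m (cone_chain m c) = c - cone_chain m (delta m c)"
  using assms
proof (induction c rule: frag_induction)
  case (one xs)
  let ?L = "length xs" and ?ys = "shift_list m xs"
  have id: "map (\<lambda>x. x mod int m) xs = xs"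
    using one by (intro map_idI) (auto simp: YB_basis_def carrier_integer_mod_group split: if_splits)
  have "face_sum m (0 # ?ys) =
      frag_of (YB_dr m 1 (0 # ?ys)) +
      (\<Sum>i = 1..?L. frag_cmul ((- 1) ^ i) (frag_of (YB_dr m (Suc i) (0 # ?ys))))"
    unfolding face_sum_def
    by (simp add: shift_list_def sum.atLeast_Suc_atMost sum.shift_bounds_cl_Suc_ivl
        del: sum.cl_ivl_Suc)
  also have "YB_dr m 1 (0 # ?ys) = xs"
    by (simp add: YB_dr_def shift_list_def o_def mod_simps id)
  also have "(\<Sum>i = 1..?L. frag_cmul ((- 1) ^ i) (frag_of (YB_dr m (Suc i) (0 # ?ys)))) =
      (\<Sum>i = 1..?L. - frag_cmul ((- 1) ^ (i - 1)) (frag_of (0 # shift_list m (YB_dr m i xs))))"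
  proof (rule sum.cong)
    fix i assume "i \<in> {1..?L}"
    then obtain j where i: "i = Suc j" by (cases i) auto
    then have "YB_dr m (Suc i) (0 # ?ys) = 0 # YB_dr m i ?ys" by (simp add: YB_dr_def)
    then show "frag_cmul ((- 1) ^ i) (frag_of (YB_dr m (Suc i) (0 # ?ys))) =
      - frag_cmul ((- 1) ^ (i - 1)) (frag_of (0 # shift_list m (YB_dr m i xs)))"
      by (simp add: i shift_list_YB_dr)
  qed simp
  also have "\<dots> = - cone_chain m (face_sum m xs)"
    unfolding face_sum_def cone_chain_def
    by (simp add: frag_extend_sum o_def frag_extend_cmul sum_negf del: minus_frag_cmul)
  finally show ?case by simp
qed (auto simp: delta_diff cone_chain_diff)

lemma shift_slide:
  assumes "0 < m" "Poly_Mapping.keys c \<subseteq> YB_basis m n"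
  shows "shift m (slide m c) - slide m c = c - orbit_rep m c"
  using assms(2)
proof (induction c rule: frag_induction)
  case (one xs)
  define f where "f k = frag_of (map (\<lambda>x. (x - int k) mod int m) xs)" for k
  have xs: "0 \<le> hd xs" "map (\<lambda>x. x mod int m) xs = xs"
    using one assms(1) by (cases xs; auto simp: YB_basis_def carrier_integer_mod_group
        intro!: map_idI)+
  have "shift m (f k) = f (Suc k)" for k
    by (simp add: f_def shift_list_def o_def mod_simps algebra_simps)
  then have "shift m (\<Sum>k<N. f k) = (\<Sum>k<N. f (Suc k))" for N
    by (induction N) (simp_all add: shift_add)
  then have "shift m (- (\<Sum>k<N. f k)) - (- (\<Sum>k<N. f k)) = f 0 - f N" for N
    using shift_diff[of m 0 "\<Sum>k<N. f k"]
    by (simp add: sum_subtractf[symmetric] sum_lessThan_telescope' flip: diff_conv_add_uminus)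
  from this[of "nat (hd xs)"] show ?case
    using xs by (simp add: f_def)
qed (auto simp: shift_diff slide_diff orbit_rep_diff algebra_simps)

lemma lookup_shift:
  assumes "0 < m" "Poly_Mapping.keys c \<subseteq> YB_basis m n" "xs \<in> YB_basis m n"
  shows "Poly_Mapping.lookup (shift m c) (shift_list m xs) = Poly_Mapping.lookup c xs"
  using assms(2)
proof (induction c rule: frag_induction)
  case (one ys)
  have id: "map (\<lambda>x. (x + 1) mod int m) (shift_list m zs) = zs" if "zs \<in> YB_basis m n" for zs
    using that assms(1) unfolding shift_list_def map_map o_def
    by (intro map_idI) (auto simp: YB_basis_def carrier_integer_mod_group mod_simps)
  have "shift_list m xs = shift_list m ys \<longleftrightarrow> xs = ys"
    using id[OF one] id[OF assms(3)] by metis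
  then show ?case by simp
qed (auto simp: shift_diff lookup_minus)

text \<open>Translation lowers a positive first entry by 1, so invariance carries every coefficient
  to one at a list starting with 0; hence the induction on the first entry.\<close>

lemma shift_invariant_eq_0:
  assumes "0 < m" "Poly_Mapping.keys d \<subseteq> YB_basis m n" "shift m d = d"
    and "\<And>xs. 0 # xs \<in> YB_basis m n \<Longrightarrow> Poly_Mapping.lookup d (0 # xs) = 0"
  shows "d = 0"
proof -
  have "Poly_Mapping.lookup d xs = 0" if "xs \<in> YB_basis m n" "nat (hd xs) = k" for k xs
    using that
  proof (induction k arbitrary: xs)
    case 0
    then obtain y ys where "xs = y # ys" by (cases xs) (auto simp: YB_basis_def)
    with 0 assms(1,4) show ?case by (auto simp: YB_basis_def carrier_integer_mod_group)
  next
    case (Suc k)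
    then obtain y ys where xs: "xs = y # ys" by (cases xs) (auto simp: YB_basis_def)
    with Suc.prems assms(1) have "nat (hd (shift_list m xs)) = k"
      by (auto simp: YB_basis_def carrier_integer_mod_group shift_list_def)
    then have "Poly_Mapping.lookup d (shift_list m xs) = 0"
      by (intro Suc.IH shift_list_in_basis assms(1) Suc.prems(1))
    then show ?case
      using lookup_shift[OF assms(1,2) Suc.prems(1)] assms(3) by simp
  qed
  then show ?thesis
    using assms(2) by (intro poly_mapping_eqI) (metis in_keys_iff lookup_zero subsetD)
qed


section \<open>Faces in low degree and the bar differential of \<open>\<int>/3\<close>\<close>

lemma face_sum_3: "face_sum m [a, b, c] =
    frag_of [(b + 1) mod int m, (c + 1) mod int m] - frag_of [a, (c + 1) mod int m]
    + frag_of [a, b]"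
  by (simp add: face_sum_def YB_dr_def eval_nat_numeral)

lemma face_sum_4: "face_sum m [a, b, c, d] =
    frag_of [(b + 1) mod int m, (c + 1) mod int m, (d + 1) mod int m]
    - frag_of [a, (c + 1) mod int m, (d + 1) mod int m]
    + frag_of [a, b, (d + 1) mod int m] - frag_of [a, b, c]"
  by (simp add: face_sum_def YB_dr_def eval_nat_numeral)

lemma basis_cases_3:
  assumes "xs \<in> YB_basis m 3"
  obtains a b c where "xs = [a, b, c]" "a \<in> carrier (integer_mod_group m)"
    "b \<in> carrier (integer_mod_group m)" "c \<in> carrier (integer_mod_group m)"
proof -
  from assms have "length xs = 3" by (auto simp: YB_basis_def)
  then obtain a b c where "xs = [a, b, c]" by (auto simp: length_Suc_conv eval_nat_numeral)
  with assms show thesis by (intro that) (auto simp: YB_basis_def)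
qed

lemma basis_cases_4:
  assumes "xs \<in> YB_basis m 4"
  obtains a b c d where "xs = [a, b, c, d]" "a \<in> carrier (integer_mod_group m)"
    "b \<in> carrier (integer_mod_group m)" "c \<in> carrier (integer_mod_group m)"
    "d \<in> carrier (integer_mod_group m)"
proof -
  from assms have "length xs = 4" by (auto simp: YB_basis_def)
  then obtain a b c d where "xs = [a, b, c, d]" by (auto simp: length_Suc_conv eval_nat_numeral)
  with assms show thesis by (intro that) (auto simp: YB_basis_def)
qed

lemma carrier_integer_mod_group_3: "a \<in> carrier (integer_mod_group 3) \<longleftrightarrow> a = 0 \<or> a = 1 \<or> a = (2::int)"
  by (auto simp: carrier_integer_mod_group)

lemma delta_delta:
  assumes "Poly_Mapping.keys c \<subseteq> YB_basis m 4"
  shows "delta m (delta m c) = 0"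
  using assms
proof (induction c rule: frag_induction)
  case (one xs)
  then obtain a b c d where xs: "xs = [a, b, c, d]" by (rule basis_cases_4)
  show ?case
    by (simp add: xs face_sum_4 face_sum_3 delta_add delta_diff mod_simps)
qed (auto simp: delta_diff)

lemma orbit_rep_shift:
  assumes "Poly_Mapping.keys c \<subseteq> YB_basis m n"
  shows "orbit_rep m (shift m c) = orbit_rep m c"
  using assms
proof (induction c rule: frag_induction)
  case (one xs)
  then obtain y ys where "xs = y # ys" by (cases xs) (auto simp: YB_basis_def)
  then show ?case by (simp add: shift_list_def o_def mod_simps)
qed (auto simp: orbit_rep_diff shift_diff)

text \<open>On coinvariants \<open>\<delta>\<close> becomes the bar differential
  \<open>[g|h] \<mapsto> [h] - [g + h] + [g]\<close>; these are its coefficients at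
  \<open>[1]\<close>, \<open>[2]\<close> and \<open>[0]\<close>.\<close>

lemma orbit_rep_delta:
  assumes "Poly_Mapping.keys c \<subseteq> YB_basis 3 3"
  defines "q \<equiv> Poly_Mapping.lookup (orbit_rep 3 c)"
    and "r \<equiv> Poly_Mapping.lookup (orbit_rep 3 (delta 3 c))"
  shows "r [0, 0] = 2 * q [0, 0, 0] + q [0, 0, 1] + q [0, 1, 1] - q [0, 1, 2] \<and>
    r [0, 1] = 2 * q [0, 1, 2] + q [0, 0, 1] + q [0, 1, 1] - q [0, 0, 0] \<and>
    r [0, 2] = q [0, 2, 1] + q [0, 2, 2] + q [0, 2, 0] + q [0, 0, 2] + q [0, 1, 0]
      - q [0, 0, 1] - q [0, 1, 1]"
  using assms(1) unfolding q_def r_def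
proof (induction c rule: frag_induction)
  case (one xs)
  then obtain i j k where xs: "xs = [i, j, k]" "i \<in> carrier (integer_mod_group 3)"
    "j \<in> carrier (integer_mod_group 3)" "k \<in> carrier (integer_mod_group 3)"
    by (rule basis_cases_3)
  from xs(2-4) show ?case
    unfolding xs(1) carrier_integer_mod_group_3
    by (elim disjE; hypsubst; simp add: face_sum_3 chain_map_linear lookup_add lookup_minus)
next
  case (diff a b)
  then show ?case by (simp add: delta_diff orbit_rep_diff lookup_minus)
qed simp

text \<open>
  The bar generator \<open>[g\<^sub>1|g\<^sub>2]\<close> is the orbit of \<open>[0, g\<^sub>1 - 1, g\<^sub>1 + g\<^sub>2 - 2]\<close>, and \<open>[g]\<close> that of \<open>[0, g - 1]\<close>.
  The generators missing below are \<open>[0|0]\<close>, \<open>[1|1]\<close> and \<open>[2|2]\<close>.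
\<close>

definition free_coord :: "(int list \<Rightarrow>\<^sub>0 int) \<Rightarrow> nat \<Rightarrow> int" where
  "free_coord c j =
     ([Poly_Mapping.lookup (delta 3 c) [0, 0],
       Poly_Mapping.lookup (delta 3 c) [0, 1],
       Poly_Mapping.lookup (delta 3 c) [0, 2],
       Poly_Mapping.lookup (orbit_rep 3 c) [0, 2, 2],
       Poly_Mapping.lookup (orbit_rep 3 c) [0, 2, 0],
       Poly_Mapping.lookup (orbit_rep 3 c) [0, 0, 2],
       Poly_Mapping.lookup (orbit_rep 3 c) [0, 1, 0],
       Poly_Mapping.lookup (orbit_rep 3 c) [0, 0, 1],
       Poly_Mapping.lookup (orbit_rep 3 c) [0, 1, 1]] ! j)"

text \<open>\<open>u\<^sub>1 + 2 u\<^sub>2\<close> for \<open>u\<close> read off from \<open>\<delta> e\<close>, where \<open>e\<close> is the slide of \<open>c\<close>; only its class modulo 3 matters.\<close>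

definition torsion_coord :: "(int list \<Rightarrow>\<^sub>0 int) \<Rightarrow> int" where
  "torsion_coord c =
     Poly_Mapping.lookup (delta 3 (slide 3 c)) [0, 0]
     + 2 * Poly_Mapping.lookup (delta 3 (slide 3 c)) [0, 1]"

lemma all_less_9: "(\<forall>j<9. P j) \<longleftrightarrow> P 0 \<and> P 1 \<and> P 2 \<and> P 3 \<and> P 4 \<and> P 5 \<and> P 6 \<and> P 7 \<and> P (8::nat)"
  by (simp add: numeral_eq_Suc All_less_Suc conj_ac)

lemma free_coord_add: "j < 9 \<Longrightarrow> free_coord (a + b) j = free_coord a j + free_coord b j"
proof -
  have "\<forall>j<9. free_coord (a + b) j = free_coord a j + free_coord b j"
    unfolding all_less_9 by (simp add: free_coord_def chain_map_linear lookup_add)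
  then show "j < 9 \<Longrightarrow> free_coord (a + b) j = free_coord a j + free_coord b j" by blast
qed

lemma torsion_coord_add: "torsion_coord (a + b) = torsion_coord a + torsion_coord b"
  by (simp add: torsion_coord_def chain_map_linear lookup_add)

lemma torsion_coord_diff: "torsion_coord (a - b) = torsion_coord a - torsion_coord b"
  by (simp add: torsion_coord_def chain_map_linear lookup_minus)

section \<open>Coordinates of boundaries\<close>

lemma keys_YB_boundary:
  assumes "0 < m" "2 \<le> n" "Poly_Mapping.keys c \<subseteq> YB_basis m n"
  shows "Poly_Mapping.keys (YB_boundary m n c) \<subseteq> YB_basis m (n - 1)"
  using keys_delta[OF assms] keys_shift[OF assms(1) keys_delta[OF assms]]
    keys_diff[of "shift m (delta m c)" "delta m c"]
  unfolding YB_boundary_eq[OF assms(2,3)] by blast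

lemma free_coord_boundary:
  assumes "Poly_Mapping.keys b \<subseteq> YB_basis 3 4" "j < 9"
  shows "free_coord (YB_boundary 3 4 b) j = 0"
proof -
  have b: "YB_boundary 3 4 b = shift 3 (delta 3 b) - delta 3 b"
    using assms(1) by (intro YB_boundary_eq) auto
  have "Poly_Mapping.keys (delta 3 b) \<subseteq> YB_basis 3 3"
    using keys_delta[OF _ _ assms(1)] by simp
  then have "orbit_rep 3 (YB_boundary 3 4 b) = 0"
    by (simp add: b orbit_rep_diff orbit_rep_shift)
  moreover have "delta 3 (YB_boundary 3 4 b) = 0"
    by (simp add: b delta_diff delta_delta[OF assms(1)] flip: shift_delta)
  ultimately have "\<forall>j<9. free_coord (YB_boundary 3 4 b) j = 0"
    unfolding all_less_9 by (simp add: free_coord_def)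
  with assms(2) show ?thesis by blast
qed

text \<open>For \<open>d = \<delta> b\<close> the slide of \<open>(t - 1) d\<close> is
  \<open>d - (1 + t + t\<^sup>2) p\<close>, with \<open>p\<close> the part of \<open>d\<close> on
  lists starting with 0. As \<open>\<delta> d = 0\<close>, the \<open>u\<close> read off is minus a
  bar boundary, and its weighted sum vanishes modulo 3 because \<open>h - (g + h) + g = 0\<close>.
  By linearity this is checked on basis lists.\<close>

lemma torsion_coord_boundary:
  assumes "Poly_Mapping.keys b \<subseteq> YB_basis 3 4"
  shows "3 dvd torsion_coord (YB_boundary 3 4 b)"
proof -
  have "3 dvd torsion_coord (shift 3 (delta 3 b)) - torsion_coord (delta 3 b)"
    using assms
  proof (induction b rule: frag_induction)
    case (one xs)
    then obtain i j k l where xs: "xs = [i, j, k, l]" "i \<in> carrier (integer_mod_group 3)"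
      "j \<in> carrier (integer_mod_group 3)" "k \<in> carrier (integer_mod_group 3)"
      "l \<in> carrier (integer_mod_group 3)"
      by (rule basis_cases_4)
    from xs(2-5) show ?case
      unfolding xs(1) carrier_integer_mod_group_3
      by (elim disjE; hypsubst; simp add: face_sum_4 face_sum_3 torsion_coord_def shift_list_def
          chain_map_linear lookup_add lookup_minus numeral_2_eq_2)
  next
    case (diff a b)
    then show ?case
      unfolding delta_diff shift_diff torsion_coord_diff by presburger
  qed (simp add: torsion_coord_def)
  moreover have "YB_boundary 3 4 b = shift 3 (delta 3 b) - delta 3 b"
    using assms by (intro YB_boundary_eq) auto
  ultimately show ?thesis
    by (simp add: torsion_coord_diff)
qed

section \<open>Cycles with vanishing coordinates\<close>

lemma cycle_is_boundary:
  assumes "Poly_Mapping.keys c \<subseteq> YB_basis 3 3" "YB_boundary 3 3 c = 0"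
    and coord: "\<And>j. j < 9 \<Longrightarrow> free_coord c j = 0" "3 dvd torsion_coord c"
  shows "\<exists>b. Poly_Mapping.keys b \<subseteq> YB_basis 3 4 \<and> c = YB_boundary 3 4 b"
proof -
  have coord9: "\<forall>j<9. free_coord c j = 0" using coord(1) by blast
  have inv: "shift 3 (delta 3 c) = delta 3 c"
    using assms(2) YB_boundary_eq[OF _ assms(1)] by simp
  have keys_c: "Poly_Mapping.keys (delta 3 c) \<subseteq> YB_basis 3 2"
    using keys_delta[OF _ _ assms(1)] by simp
  have basis_2: "xs = [0] \<or> xs = [1] \<or> xs = [2]" if "0 # xs \<in> YB_basis 3 2" for xs
    using that by (auto simp: YB_basis_def length_Suc_conv carrier_integer_mod_group_3)
  \<comment> \<open>The first three free coordinates are the coefficients of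
    \<open>delta 3 c\<close> at the three orbit representatives in degree 2.\<close>
  have delta_c: "delta 3 c = 0"
    using keys_c inv coord9 unfolding all_less_9
    by (intro shift_invariant_eq_0[of 3 _ 2]) (auto dest: basis_2 simp: free_coord_def)
  have rep_c: "orbit_rep 3 c = 0"
  proof (rule poly_mapping_eqI)
    fix xs
    \<comment> \<open>For the three coefficients outside \<open>free_coord\<close>, the relations
      reduce to \<open>2 x = y\<close> and \<open>2 y = x\<close> for \<open>[0, 0, 0]\<close> and
      \<open>[0, 1, 2]\<close>, so both vanish, and then the third relation kills
      \<open>[0, 2, 1]\<close>.\<close>
    have "Poly_Mapping.lookup (orbit_rep 3 c) [0, x, y] = 0"
      if "x \<in> carrier (integer_mod_group 3)" "y \<in> carrier (integer_mod_group 3)" for x y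
      using that orbit_rep_delta[OF assms(1)] coord9 unfolding all_less_9
      by (auto simp: free_coord_def delta_c carrier_integer_mod_group_3)
    moreover have "Poly_Mapping.keys (orbit_rep 3 c) \<subseteq>
        {[0, x, y] | x y. x \<in> carrier (integer_mod_group 3) \<and> y \<in> carrier (integer_mod_group 3)}"
      unfolding orbit_rep_def using assms(1)
      by (intro order_trans[OF keys_frag_extend])
        (auto simp: keys_frag_of carrier_integer_mod_group elim!: basis_cases_3 dest!: subsetD)
    ultimately show "Poly_Mapping.lookup (orbit_rep 3 c) xs = Poly_Mapping.lookup 0 xs"
      by (cases "xs \<in> Poly_Mapping.keys (orbit_rep 3 c)") (auto simp: in_keys_iff)
  qed
  \<comment> \<open>As \<open>orbit_rep 3 c = 0\<close>, \<open>(t - 1) e = c\<close>; then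
    \<open>\<delta> e\<close> is invariant because \<open>\<delta> c = 0\<close>.\<close>
  define e where "e = slide 3 c"
  have keys_e: "Poly_Mapping.keys e \<subseteq> YB_basis 3 3"
    unfolding e_def using assms(1) by (intro keys_slide) auto
  have shift_e: "shift 3 e = e + c"
    using shift_slide[OF _ assms(1)] rep_c by (simp add: e_def algebra_simps)
  define u where "u = Poly_Mapping.lookup (delta 3 e)"
  obtain v where v: "u [0, 0] + 2 * u [0, 1] = 3 * v"
    using coord(2) by (auto simp: torsion_coord_def u_def e_def)
  \<comment> \<open>\<open>p\<close> solves \<open>\<delta> p = u\<close> in the bar complex: \<open>[1|1]\<close> has boundary \<open>2[1] - [2]\<close>, and
    \<open>[1|1] + [1|2] + [0|0]\<close> has boundary \<open>3[1]\<close>.\<close>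
  define p where "p = frag_cmul (u [0, 2] + v) (frag_of [0, 2, 1 :: int])
    + frag_cmul (v - u [0, 1]) (frag_of [0, 0, 0]) + frag_cmul v (frag_of [0, 0, 1])"
  \<comment> \<open>Subtracting an invariant chain keeps \<open>(t - 1) e = c\<close>; the choice of
    \<open>p\<close> makes it cancel \<open>\<delta> e\<close>.\<close>
  define e' where "e' = e - (p + shift 3 p + shift 3 (shift 3 p))"
  have "shift 3 (shift 3 (shift 3 p)) = p"
    by (simp add: p_def chain_map_linear shift_list_def)
  then have shift_e': "shift 3 e' = e' + c"
    by (simp add: e'_def chain_map_linear shift_e)
  have keys_e': "Poly_Mapping.keys e' \<subseteq> YB_basis 3 3"
  proof -
    have "Poly_Mapping.keys p \<subseteq> YB_basis 3 3"
      unfolding p_def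
      by (intro order_trans[OF keys_add] Un_least order_trans[OF keys_cmul])
        (auto simp: keys_frag_of YB_basis_def carrier_integer_mod_group)
    then show ?thesis
      unfolding e'_def using keys_e
      by (intro order_trans[OF keys_diff] order_trans[OF keys_add] Un_least keys_shift) auto
  qed
  have "delta 3 e' = 0"
  proof (rule shift_invariant_eq_0[of 3 _ 2])
    show "Poly_Mapping.keys (delta 3 e') \<subseteq> YB_basis 3 2"
      using keys_delta[OF _ _ keys_e'] by simp
    show "shift 3 (delta 3 e') = delta 3 e'"
      by (simp add: shift_delta shift_e' delta_add delta_c)
    show "Poly_Mapping.lookup (delta 3 e') (0 # xs) = 0" if "0 # xs \<in> YB_basis 3 2" for xs
      using basis_2[OF that] v
      by (auto simp: e'_def p_def chain_map_linear shift_list_def face_sum_3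
          lookup_add lookup_minus u_def[symmetric])
  qed simp
  \<comment> \<open>So \<open>c = (t - 1) e'\<close> is the image under \<open>\<partial>\<close> of
    the cone over \<open>e'\<close>.\<close>
  then have "delta 3 (cone_chain 3 e') = e'"
    using delta_cone_chain[OF keys_e'] by simp
  moreover have "Poly_Mapping.keys (cone_chain 3 e') \<subseteq> YB_basis 3 4"
    using keys_cone_chain[OF _ keys_e'] by simp
  ultimately show ?thesis
    using shift_e' by (intro exI[of _ "cone_chain 3 e'"]) (simp add: YB_boundary_eq)
qed

section \<open>Cycles realising all coordinate values\<close>

lemma coords_surj:
  obtains c where "Poly_Mapping.keys c \<subseteq> YB_basis 3 3" "YB_boundary 3 3 c = 0"
    "\<forall>j<9. free_coord c j = f j" "3 dvd torsion_coord c - t"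
proof -
  let ?cycle = "\<lambda>c. Poly_Mapping.keys c \<subseteq> YB_basis 3 3 \<and> shift 3 (delta 3 c) = delta 3 c"
  \<comment> \<open>Cycles dual to the coordinates, found by a search for short ones.\<close>
  define z0 where "z0 = frag_of [1, 1, 1] + frag_of [2, 0, 1] + frag_of [2, 2, 2 :: int]"
  define z1 where "z1 = frag_of [0, 1, 2] + frag_of [2, 0, 1] + frag_of [2, 2, 2 :: int]"
  define z2 where "z2 = frag_of [0, 2, 1] + frag_of [1, 0, 2] + frag_of [2, 1, 0 :: int]"
  define z3 where "z3 = frag_of [1, 0, 0] - frag_of [1, 0, 2 :: int]"
  define z4 where "z4 = frag_of [0, 2, 0] - frag_of [0, 2, 1 :: int]"
  define z5 where "z5 = frag_of [0, 0, 2] - frag_of [1, 0, 2 :: int]"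
  define z6 where "z6 = frag_of [0, 1, 0] - frag_of [2, 1, 0 :: int]"
  define z7 where "z7 = frag_of [0, 0, 1] + frag_of [0, 2, 1] - frag_of [2, 0, 1]
    - frag_of [2, 2, 2 :: int]"
  define z8 where "z8 = frag_of [0, 0, 0] + frag_of [0, 1, 1] + frag_of [0, 2, 1] - z0"
  \<comment> \<open>The torsion class: \<open>w = (t - 1) z0\<close>, where
    \<open>\<delta> z0 = (1 + t + t\<^sup>2) [0, 0]\<close>. Its free coordinates are 0 and its
    torsion coordinate is 1.\<close>
  define w where "w = frag_of [0, 0, 0] + frag_of [1, 2, 0] - frag_of [2, 0, 1]
    - frag_of [2, 2, 2 :: int]"
  note z_defs = z0_def z1_def z2_def z3_def z4_def z5_def z6_def z7_def z8_def w_def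
  define c where "c = frag_cmul (f 0) z0 + frag_cmul (f 1) z1 + frag_cmul (f 2) z2
    + frag_cmul (f 3) z3 + frag_cmul (f 4) z4 + frag_cmul (f 5) z5 + frag_cmul (f 6) z6
    + frag_cmul (f 7) z7 + frag_cmul (f 8) z8 + frag_cmul t w"
  have of: "Poly_Mapping.keys (frag_of [i, j, k]) \<subseteq> YB_basis 3 3"
    if "{i, j, k} \<subseteq> {0, 1, 2}" for i j k
    using that by (auto simp: keys_frag_of YB_basis_def carrier_integer_mod_group_3)
  note closed = order_trans[OF keys_add Un_least] order_trans[OF keys_diff Un_least]
    order_trans[OF keys_cmul]
  have "Poly_Mapping.keys c \<subseteq> YB_basis 3 3"
    unfolding c_def z_defs by (intro closed of; simp)
  moreover have "shift 3 (delta 3 z) = delta 3 z"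
    if "z \<in> {z0, z1, z2, z3, z4, z5, z6, z7, z8, w}" for z
    using that by (auto simp: z_defs chain_map_linear face_sum_3 shift_list_def)
  then have "shift 3 (delta 3 c) = delta 3 c"
    by (simp add: c_def chain_map_linear)
  ultimately have "Poly_Mapping.keys c \<subseteq> YB_basis 3 3" "YB_boundary 3 3 c = 0"
    by (simp_all add: YB_boundary_eq)
  moreover have "\<forall>j<9. free_coord c j = f j"
    unfolding all_less_9
    by (simp add: free_coord_def c_def z_defs chain_map_linear face_sum_3 lookup_add lookup_minus)
  \<comment> \<open>The cycles \<open>z0\<close> to \<open>z8\<close> have torsion coordinates
    divisible by 3, so the class of \<open>t\<close> is prescribed independently of
    \<open>f\<close>.\<close>
  moreover have "torsion_coord c - t = 3 * (f 7 + f 8 - f 0 - f 1)"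
    by (simp add: torsion_coord_def c_def z_defs chain_map_linear face_sum_3 lookup_add
        lookup_minus numeral_2_eq_2)
  ultimately show thesis by (intro that[of c]) auto
qed

section \<open>The isomorphism given by the coordinates\<close>

theorem theorem3p19:
  shows "YB_homology_group 3 3
           \<cong> product_group {..<9::nat} (\<lambda>_. integer_group) \<times>\<times> integer_mod_group 3"
proof -
  let ?C = "YB_chain_group 3 3" and ?Z = "YB_cycles 3 3"
  let ?H = "product_group {..<9::nat} (\<lambda>_. integer_group) \<times>\<times> integer_mod_group 3"
  let ?G = "subgroup_generated ?C ?Z"
  let ?\<Phi> = "\<lambda>c. (restrict (free_coord c) {..<9}, torsion_coord c mod 3)"
  have cycles: "c \<in> ?Z \<longleftrightarrow> Poly_Mapping.keys c \<subseteq> YB_basis 3 3 \<and> YB_boundary 3 3 c = 0" for c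
    by (simp add: YB_cycles_def kernel_def YB_chain_group_def)
  \<comment> \<open>As a kernel, \<open>?Z\<close> is already a subgroup, so the subgroup it
    generates has carrier exactly \<open>?Z\<close>.\<close>
  have "group_hom ?C (YB_chain_group 3 (3 - 1)) (YB_boundary 3 3)"
    unfolding group_hom_def group_hom_axioms_def YB_chain_group_def hom_def
    using keys_YB_boundary[of 3 3]
    by (auto simp: YB_boundary_def frag_extend_add)
  then have "subgroup ?Z ?C"
    unfolding YB_cycles_def by (rule group_hom.subgroup_kernel)
  then have carrier_G: "carrier ?G = ?Z"
    by (rule subgroup.carrier_subgroup_generated_subgroup)
  have mult_C: "x \<otimes>\<^bsub>?C\<^esub> y = x + y" for x y
    by (simp add: YB_chain_group_def)
  interpret \<Phi>: group_hom ?G ?H ?\<Phi>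
  proof (intro group_hom.intro group_hom_axioms.intro)
    show "group ?G"
      by (simp add: YB_chain_group_def group.group_subgroup_generated)
    show "group ?H"
      by (intro DirProd_group product_group group_integer_mod_group) simp
    show "?\<Phi> \<in> hom ?G ?H"
      by (rule homI)
        (auto simp: mult_C carrier_integer_mod_group free_coord_add torsion_coord_add mod_simps)
  qed
  have "?\<Phi> ` carrier ?G = carrier ?H"
  proof
    show "carrier ?H \<subseteq> ?\<Phi> ` carrier ?G"
    proof
      fix y assume y: "y \<in> carrier ?H"
      obtain c where c: "Poly_Mapping.keys c \<subseteq> YB_basis 3 3" "YB_boundary 3 3 c = 0"
        "\<forall>j<9. free_coord c j = fst y j" "3 dvd torsion_coord c - snd y"
        by (rule coords_surj)
      obtain f t where ft: "y = (f, t)" "f \<in> {..<9} \<rightarrow>\<^sub>E UNIV" "0 \<le> t" "t < 3"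
        using y by (cases y) (auto simp: carrier_integer_mod_group)
      \<comment> \<open>Outside \<open>{..<9}\<close> both sides are \<open>undefined\<close>, since
        members of the product group are extensional.\<close>
      have "restrict (free_coord c) {..<9} = f"
      proof
        fix j
        show "restrict (free_coord c) {..<9} j = f j"
          using c(3) PiE_arb[OF ft(2), of j] by (cases "j < 9") (simp_all add: ft(1))
      qed
      moreover have "torsion_coord c mod 3 = t"
        using c(4) mod_eq_dvd_iff[of "torsion_coord c" 3 t] mod_pos_pos_trivial[OF ft(3,4)]
        by (metis ft(1) snd_conv)
      ultimately have "?\<Phi> c = y" by (simp add: ft(1))
      then show "y \<in> ?\<Phi> ` carrier ?G"
        using c(1,2) by (intro image_eqI[of _ _ c]) (auto simp: carrier_G cycles)
    qed
  qed (use \<Phi>.hom_closed in blast)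
  then have "?G Mod kernel ?G ?H ?\<Phi> \<cong> ?H"
    by (rule \<Phi>.FactGroup_iso)
  also have "kernel ?G ?H ?\<Phi> = YB_boundaries 3 3"
  proof (intro subset_antisym subsetI)
    fix c assume "c \<in> kernel ?G ?H ?\<Phi>"
    then have c: "Poly_Mapping.keys c \<subseteq> YB_basis 3 3" "YB_boundary 3 3 c = 0"
      and eq: "restrict (free_coord c) {..<9} = (\<lambda>_\<in>{..<9}. 0)" "3 dvd torsion_coord c"
      by (auto simp: kernel_def carrier_G cycles)
    have "free_coord c j = 0" if "j < 9" for j
      using fun_cong[OF eq(1), of j] that by simp
    then show "c \<in> YB_boundaries 3 3"
      using cycle_is_boundary[OF c _ eq(2)] by (auto simp: YB_boundaries_def YB_chain_group_def)
  next
    fix c assume "c \<in> YB_boundaries 3 3"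
    then obtain b where b: "Poly_Mapping.keys b \<subseteq> YB_basis 3 4" "c = YB_boundary 3 4 b"
      by (auto simp: YB_boundaries_def YB_chain_group_def)
    have keys_c: "Poly_Mapping.keys c \<subseteq> YB_basis 3 3"
      using keys_YB_boundary[OF _ _ b(1)] b(2) by simp
    moreover have "delta 3 c = 0"
      using b delta_delta[OF b(1)] shift_delta[of 3 "delta 3 b"]
      by (simp add: YB_boundary_eq delta_diff)
    then have "YB_boundary 3 3 c = 0"
      using keys_c by (simp add: YB_boundary_eq)
    ultimately show "c \<in> kernel ?G ?H ?\<Phi>"
      using free_coord_boundary[OF b(1)] torsion_coord_boundary[OF b(1)]
      by (auto simp: kernel_def carrier_G cycles b(2) intro!: restrict_ext)
  qed
  finally show ?thesis
    by (simp add: YB_homology_group_def)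
qed

end
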